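(* Let $K\subset \mathbb{R}^n$ be a closed convex set containing the origin in its interior. If $C\subset \mathbb{R}^n$ is a bounded closed convex set such that $K=C^*$, then $\hat K \subset C$ (inclusion, not necessarily strict).
   Context: $\langle\cdot,\cdot\rangle$ is the standard inner product on $\mathbb{R}^n$. The polar of a set $A\subseteq\mathbb{R}^n$ is $A^* = \{y\in\mathbb{R}^n\mid \langle x,y \rangle \leq 1 \text{ for all } x\in A\}$, and $\hat K = \{y\in K^* \mid \langle x,y \rangle = 1 \text{ for some } x\in K\}$. *)

theory Defs
  imports "HOL-Analysis.Analysis"
begin

definition polar :: "'a::real_inner set \<Rightarrow> 'a set" where
  "polar A = {y. \<forall>x\<in>A. x \<bullet> y \<le> 1}"

definition polar_hat :: "'a::real_inner set \<Rightarrow> 'a set" where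
  "polar_hat K = {y \<in> polar K. \<exists>x\<in>K. x \<bullet> y = 1}"

end

theory Submission
  imports Defs
begin

text \<open>If \<open>y \<in> polar_hat K\<close> were outside \<open>C\<close>, a hyperplane would strictly separate it from \<open>C\<close>.
  Tilting the functional \<open>x \<in> K\<close> with \<open>x \<bullet> y = 1\<close> slightly in the separating direction makes its
  value at \<open>y\<close> exceed its supremum over \<open>C\<close> while keeping the separating level positive, so after
  rescaling it lies in \<open>polar C = K\<close> but violates \<open>y \<in> polar K\<close>. The small tilt avoids
  assuming \<open>0 \<in> C\<close>.\<close>

lemma polar_hat_polar_subset:
  fixes C :: "'a::euclidean_space set"
  assumes "closed C" and "convex C"
  shows "polar_hat (polar C) \<subseteq> C"
proof
  fix y
  assume "y \<in> polar_hat (polar C)"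
  then obtain x where y: "\<And>z. z \<in> polar C \<Longrightarrow> z \<bullet> y \<le> 1"
    and x: "x \<in> polar C" "x \<bullet> y = 1"
    by (auto simp: polar_hat_def polar_def)
  show "y \<in> C"
  proof (rule ccontr)
    assume "y \<notin> C"
    then obtain a b where ay: "a \<bullet> y < b" and aC: "\<And>c. c \<in> C \<Longrightarrow> b < a \<bullet> c"
      using separating_hyperplane_closed_point[OF assms(2,1)] by blast
    \<comment> \<open>This choice gives \<open>\<bar>t * b\<bar> < 1\<close> whatever the sign of
      \<open>b\<close>, so the divisor \<open>1 - t * b\<close> is positive.\<close>
    define t where "t = 1 / (1 + \<bar>b\<bar>)"
    have "t > 0" by (simp add: t_def)
    have pos: "1 - t * b > 0"
      by (simp add: t_def field_simps)
    \<comment> \<open>On \<open>C\<close> the functional \<open>x\<close> is at most 1 and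
      \<open>a\<close> exceeds \<open>b\<close>, so \<open>x - t *\<^sub>R a\<close> is at most
      \<open>1 - t * b\<close>, the normalising factor.\<close>
    define z where "z = (1 / (1 - t * b)) *\<^sub>R (x - t *\<^sub>R a)"
    have "c \<bullet> z \<le> 1" if "c \<in> C" for c
    proof -
      have "c \<bullet> x \<le> 1" using x(1) that by (simp add: polar_def)
      moreover have "t * b \<le> t * (c \<bullet> a)"
        using aC[OF that] \<open>t > 0\<close> by (simp add: inner_commute)
      ultimately show ?thesis
        using pos by (simp add: z_def inner_diff_right)
    qed
    then have "z \<bullet> y \<le> 1" by (intro y) (simp add: polar_def)
    \<comment> \<open>Clear the divisor and use \<open>x \<bullet> y = 1\<close>; since
      \<open>t > 0\<close> this forces \<open>b \<le> a \<bullet> y\<close>.\<close>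
    then have "1 - t * (a \<bullet> y) \<le> 1 - t * b"
      using pos x(2) by (simp add: z_def inner_diff_left)
    then show False using ay \<open>t > 0\<close> by simp
  qed
qed

theorem theorem2:
  fixes K C :: "(real ^ 'n) set"
  assumes "closed K" and "convex K" and "0 \<in> interior K"
    and "bounded C" and "closed C" and "convex C"
    and "K = polar C"
  shows "polar_hat K \<subseteq> C"
  using assms(5-7) polar_hat_polar_subset by blast

end
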